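(* There is an absolute constant $C$ such that the following holds. Let $\Gamma$ be a graph on $N$ vertices whose edges are colored so that each color class has maximum degree at most $\Delta$, and let $0<\lambda\le 1$, $K>0$ and $n\ge 1$. Then the number of $n$-vertex subsets $S$ of $V(\Gamma)$ for which there is a set of at most $Kn$ colors such that the graph on $S$ formed by the edges of $\Gamma$ inside $S$ with colors in this set is a $\lambda$-edge-expander is at most $N^{C\Delta\lambda^{-1}K\ln n}(C\Delta\lambda^{-1}K)^n$.
   Context: A graph $H=(U,E)$ with $|U|=m$ is a $\lambda$-edge-expander if for every $X\subseteq U$, the number of edges between $X$ and $U\setminus X$ is at least $\lambda|X|(m-|X|)$.
   Formalization: Proved for n ≥ 2 instead of n ≥ 1: for n = 1 every singleton is trivially a λ-edge-expander, so the count is N, while the bound CΔλ^{-1}K does not depend on N, and the claim fails for large N. *)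

theory Defs
  imports Complex_Main
begin

definition simple_graph :: "'a set \<Rightarrow> 'a set set \<Rightarrow> bool" where
  "simple_graph V E \<longleftrightarrow> finite V \<and> (\<forall>e\<in>E. e \<subseteq> V \<and> card e = 2)"

definition degree :: "'a set set \<Rightarrow> 'a \<Rightarrow> nat" where
  "degree E v = card {e \<in> E. v \<in> e}"

definition max_degree_at_most :: "'a set \<Rightarrow> 'a set set \<Rightarrow> nat \<Rightarrow> bool" where
  "max_degree_at_most V E \<Delta> \<longleftrightarrow> (\<forall>v\<in>V. degree E v \<le> \<Delta>)"

definition color_class :: "'a set set \<Rightarrow> ('a set \<Rightarrow> 'c) \<Rightarrow> 'c \<Rightarrow> 'a set set" where
  "color_class E col c = {e \<in> E. col e = c}"

definition edges_between :: "'a set set \<Rightarrow> 'a set \<Rightarrow> 'a set \<Rightarrow> 'a set set" where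
  "edges_between E X Y = {e \<in> E. \<exists>x\<in>X. \<exists>y\<in>Y. e = {x, y}}"

definition edge_expander :: "real \<Rightarrow> 'a set \<Rightarrow> 'a set set \<Rightarrow> bool" where
  "edge_expander l U E \<longleftrightarrow>
     (\<forall>X\<subseteq>U. real (card (edges_between E X (U - X))) \<ge>
        l * real (card X) * (real (card U) - real (card X)))"

definition induced_colored_edges ::
    "'a set set \<Rightarrow> ('a set \<Rightarrow> 'c) \<Rightarrow> 'a set \<Rightarrow> 'c set \<Rightarrow> 'a set set" where
  "induced_colored_edges E col S A = {e \<in> E. e \<subseteq> S \<and> col e \<in> A}"

definition expanding_subsets ::
    "'a set \<Rightarrow> 'a set set \<Rightarrow> ('a set \<Rightarrow> 'c) \<Rightarrow> real \<Rightarrow> real \<Rightarrow> nat \<Rightarrow> 'a set set" where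
  "expanding_subsets V E col l K n =
     {S. S \<subseteq> V \<and> card S = n \<and>
         (\<exists>A. finite A \<and> real (card A) \<le> K * real n \<and>
              edge_expander l S (induced_colored_edges E col S A))}"

text \<open>
  For \<open>n = 1\<close> the exponent \<open>ln n\<close> vanishes while every singleton is trivially an expander, so
  the counting bound fails already for edgeless graphs; this is why it is stated for \<open>n \<ge> 2\<close>.
\<close>

lemma expanding_subsets_singletons:
  assumes "K > 0"
  shows "expanding_subsets V E col l K 1 = (\<lambda>v. {v}) ` V"
proof -
  have exp: "edge_expander l {v} F" for v :: 'a and F
    unfolding edge_expander_def by (auto simp: subset_singleton_iff)
  have "\<exists>A. finite A \<and> real (card A) \<le> K * real 1 \<and>
          edge_expander l {v} (induced_colored_edges E col {v} A)" for v
    using assms exp by (intro exI[of _ "{}"]) auto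
  then show ?thesis
    unfolding expanding_subsets_def by (auto simp: card_1_singleton_iff)
qed

lemma counting_bound_fails_for_one_vertex:
  fixes C l K :: real and \<Delta> :: nat
  assumes "K > 0"
  shows "\<exists>(V :: nat set) (E :: nat set set) (col :: nat set \<Rightarrow> nat).
    simple_graph V E \<and> (\<forall>c. max_degree_at_most V (color_class E col c) \<Delta>) \<and>
    real (card (expanding_subsets V E col l K 1))
      > real (card V) powr (C * real \<Delta> * inverse l * K * ln (real 1)) *
        (C * real \<Delta> * inverse l * K) ^ 1"
proof -
  obtain N :: nat where N: "C * real \<Delta> * inverse l * K < real N" "N > 0"
    by (metis reals_Archimedean2 less_trans of_nat_less_iff gr0I lessI less_imp_of_nat_less zero_less_Suc)
  have "card (expanding_subsets {..<N} {} (\<lambda>_. 0::nat) l K 1) = N"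
    unfolding expanding_subsets_singletons[OF assms] by (simp add: card_image)
  with N show ?thesis
    by (intro exI[of _ "{..<N}"] exI[of _ "{}"] exI[of _ "\<lambda>_. 0"])
      (simp add: simple_graph_def max_degree_at_most_def degree_def color_class_def)
qed

end

theory Submission
  imports Defs
begin

text \<open>
  Splitting every colour class greedily into \<open>2 * \<Delta>\<close> matchings reduces to properly coloured graphs,
  with \<open>2 * \<Delta> * K * n\<close> colours; put \<open>Q = 2 * \<Delta> * K / \<lambda>\<close>. Let \<open>S\<close> be an expanding set, and let colours
  be added one at a time. By expansion, each current component \<open>X\<close> sees at least
  \<open>\<lambda> * (n - card X)\<close> colours on its boundary, so averaging gives a colour that merges
  enough components to shrink their number minus one by the factor \<open>1 - 1 / (2 * Q)\<close>. Hence about \<open>2 * Q * ln n\<close>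
  colours connect \<open>S\<close>, and the spanning tree uses few edges from late rounds: the rounds of its edges add
  up to at most \<open>2 * Q * n\<close>.

  For a fixed colour sequence and a fixed vertex \<open>v\<close>, percolate on the graph, keeping the edges of round
  \<open>j\<close> with probability proportional to \<open>exp (- j / (2 * Q)) / Q\<close>. Each such \<open>S\<close> containing \<open>v\<close> is the cluster of
  \<open>v\<close> with probability at least \<open>(c / Q) ^ n\<close> for an absolute constant \<open>c\<close>, and these events are disjoint. So there are at most
  \<open>(Q / c) ^ n\<close> such sets; choosing \<open>v\<close> and the colours, which are among at most \<open>N ^ 2\<close>, costs the power of \<open>N\<close>.
\<close>

section \<open>Refining a colouring to a proper one\<close>

definition properly_colored :: "'a set set \<Rightarrow> ('a set \<Rightarrow> 'c) \<Rightarrow> bool" where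
  "properly_colored E col \<longleftrightarrow>
     (\<forall>e\<in>E. \<forall>e'\<in>E. e \<inter> e' \<noteq> {} \<longrightarrow> col e = col e' \<longrightarrow> e = e')"

lemma properly_coloredD:
  "properly_colored E col \<Longrightarrow> e \<in> E \<Longrightarrow> e' \<in> E \<Longrightarrow> v \<in> e \<Longrightarrow> v \<in> e' \<Longrightarrow> col e = col e' \<Longrightarrow> e = e'"
  unfolding properly_colored_def by blast

text \<open>Greedy edge colouring: at each endpoint, a new edge meets at most
  \<open>\<Delta> - 1\<close> earlier edges of its own colour, so fewer than
  \<open>2 * \<Delta>\<close> labels are blocked.\<close>

lemma proper_refinement_exists:
  fixes \<Delta> :: nat
  assumes "finite E" "\<And>e. e \<in> E \<Longrightarrow> card e = 2"
    and "\<And>c v. card {e \<in> E. v \<in> e \<and> col e = c} \<le> \<Delta>"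
  shows "\<exists>g. (\<forall>e\<in>E. g e < 2 * \<Delta>) \<and> properly_colored E (\<lambda>e. (col e, g e :: nat))"
  using assms
proof (induction E rule: finite_induct)
  case empty
  show ?case by (simp add: properly_colored_def)
next
  case (insert e E)
  have deg: "card {e' \<in> E. v \<in> e' \<and> col e' = c} \<le> \<Delta>" for c v
    by (rule order.trans[OF card_mono insert.prems(2)[of v c]]) (use insert.hyps in auto)
  obtain g where g: "\<forall>e\<in>E. g e < 2 * \<Delta>" "properly_colored E (\<lambda>e. (col e, g e :: nat))"
    using insert.IH insert.prems(1) deg by blast
  obtain x y where xy: "e = {x, y}" "x \<noteq> y"
    using insert.prems(1)[of e] by (auto simp: card_2_iff)
  let ?I = "\<lambda>F v. {e' \<in> F. v \<in> e' \<and> col e' = col e}"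
  have star: "card (?I E v) < \<Delta>" if "v \<in> e" for v
  proof -
    have "?I (insert e E) v = insert e (?I E v)" using that by auto
    then have "card (?I (insert e E) v) = Suc (card (?I E v))"
      using insert.hyps by simp
    then show ?thesis using insert.prems(2)[of v "col e"] by simp
  qed
  have "card (g ` (?I E x \<union> ?I E y)) \<le> card (?I E x) + card (?I E y)"
    by (rule order.trans[OF card_image_le card_Un_le]) (use insert.hyps in auto)
  also have "\<dots> < card {..<2 * \<Delta>}"
    using star[of x] star[of y] xy by simp
  finally have "\<not> {..<2 * \<Delta>} \<subseteq> g ` (?I E x \<union> ?I E y)"
    using insert.hyps(1) card_mono[of "g ` (?I E x \<union> ?I E y)" "{..<2 * \<Delta>}"] by auto
  then obtain k where k: "k < 2 * \<Delta>" "k \<notin> g ` (?I E x \<union> ?I E y)" by blast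
  have "properly_colored (insert e E) (\<lambda>e'. (col e', (g(e := k)) e'))"
    unfolding properly_colored_def
  proof (intro ballI impI)
    fix a b assume ab: "a \<in> insert e E" "b \<in> insert e E" "a \<inter> b \<noteq> {}"
      "(col a, (g(e := k)) a) = (col b, (g(e := k)) b)"
    show "a = b"
    proof (cases "a = e \<or> b = e")
      case True
      show ?thesis
      proof (rule ccontr)
        assume "a \<noteq> b"
        with True ab obtain b' where "b' \<in> E" "b' \<noteq> e" "b' \<inter> e \<noteq> {}" "col b' = col e" "k = g b'"
          by (auto split: if_splits)
        with k xy show False by auto
      qed
    next
      case False
      then show ?thesis using ab g(2) unfolding properly_colored_def by auto
    qed
  qed
  moreover have "\<forall>e'\<in>insert e E. (g(e := k)) e' < 2 * \<Delta>"
    using g(1) k(1) by auto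
  ultimately show ?case by blast
qed

section \<open>Boundary colours and greedy merging of components\<close>

text \<open>Sending a boundary edge to its colour and its endpoint in \<open>X\<close> is injective,
  since at one vertex a colour determines the edge. So there are at most \<open>card X\<close>
  boundary edges per colour, and the factor \<open>card X\<close> cancels from the expansion
  bound.\<close>

lemma boundary_colors_of_expander:
  assumes "properly_colored E col" "finite S" "finite A" "X \<subseteq> S" "X \<noteq> {}"
    and exp: "edge_expander l S (induced_colored_edges E col S A)"
  shows "l * (real (card S) - real (card X))
    \<le> real (card {c \<in> A. \<exists>x\<in>X. \<exists>y\<in>S - X. {x, y} \<in> E \<and> col {x, y} = c})"
proof -
  let ?B = "edges_between (induced_colored_edges E col S A) X (S - X)"
  let ?C = "{c \<in> A. \<exists>x\<in>X. \<exists>y\<in>S - X. {x, y} \<in> E \<and> col {x, y} = c}"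
  define h where "h e = (col e, SOME x. x \<in> X \<and> x \<in> e)" for e
  have fin: "finite X" using assms finite_subset by blast
  have some: "(SOME x. x \<in> X \<and> x \<in> e) \<in> X \<and> (SOME x. x \<in> X \<and> x \<in> e) \<in> e" if "e \<in> ?B" for e
    by (rule someI_ex) (use that in \<open>auto simp: edges_between_def\<close>)
  have BE: "?B \<subseteq> E" by (auto simp: edges_between_def induced_colored_edges_def)
  have "inj_on h ?B"
  proof (rule inj_onI)
    fix e e' assume *: "e \<in> ?B" "e' \<in> ?B" "h e = h e'"
    then show "e = e'"
      using properly_coloredD[OF assms(1), of e e' "SOME x. x \<in> X \<and> x \<in> e"] some[of e] some[of e'] BE
      by (auto simp: h_def)
  qed
  moreover have "h ` ?B \<subseteq> ?C \<times> X"
    using some by (auto simp: h_def) (auto simp: edges_between_def induced_colored_edges_def)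
  ultimately have "card ?B \<le> card (?C \<times> X)"
    using fin assms(3) by (intro card_inj_on_le[of h]) auto
  moreover have "l * real (card X) * (real (card S) - real (card X)) \<le> real (card ?B)"
    using exp assms(4) unfolding edge_expander_def by blast
  ultimately have "l * real (card X) * (real (card S) - real (card X)) \<le> real (card (?C \<times> X))"
    by linarith
  then have "real (card X) * (l * (real (card S) - real (card X))) \<le> real (card X) * real (card ?C)"
    by (simp add: card_cartesian_product mult_ac)
  moreover have "real (card X) > 0" using assms(5) fin by (simp add: card_gt_0_iff)
  ultimately show ?thesis by (simp only: mult_le_cancel_left_pos)
qed

text \<open>A labelling \<open>f\<close> of \<open>S\<close> stands for the partition of \<open>S\<close> into its fibres; the following says
  that every fibre lies inside one connected component of \<open>T\<close>, expressed by cuts instead of paths.\<close>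

definition spans :: "'a set set \<Rightarrow> 'a set \<Rightarrow> ('a \<Rightarrow> 'b) \<Rightarrow> bool" where
  "spans T S f \<longleftrightarrow> (\<forall>X\<subseteq>S. (\<forall>x\<in>X. \<forall>y\<in>S - X. {x, y} \<notin> T) \<longrightarrow>
     (\<forall>x\<in>X. \<forall>y\<in>S. f x = f y \<longrightarrow> y \<in> X))"

text \<open>A set not cut by the enlarged edge set is already a union of fibres of \<open>f\<close>,
  and it contains both of \<open>x\<close>, \<open>y\<close> or neither. Hence it is also closed
  under the merged label.\<close>

lemma spans_merge_edge:
  assumes "spans T S f" "x \<in> S" "y \<in> S"
  shows "spans (insert {x, y} T) S ((\<lambda>z. if z = f y then f x else z) \<circ> f)"
  unfolding spans_def
proof (intro allI impI ballI)
  fix X u w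
  assume X: "X \<subseteq> S" and cut: "\<forall>u\<in>X. \<forall>w\<in>S - X. {u, w} \<notin> insert {x, y} T"
    and uw: "u \<in> X" "w \<in> S"
      "((\<lambda>z. if z = f y then f x else z) \<circ> f) u = ((\<lambda>z. if z = f y then f x else z) \<circ> f) w"
  have cl: "w \<in> X" if "u \<in> X" "w \<in> S" "f u = f w" for u w
    using assms(1) X cut that unfolding spans_def by blast
  have "x \<in> X \<longleftrightarrow> y \<in> X"
    using cut assms(2,3) by (metis Diff_iff insertI1 insert_commute)
  moreover have "f u = f w \<or> f u = f y \<and> f w = f x \<or> f u = f x \<and> f w = f y"
    using uw(3) by (auto split: if_splits)
  ultimately show "w \<in> X"
    using cl[of u w] cl[of u x] cl[of u y] cl[of x w] cl[of y w] uw(1,2) assms(2,3) by metis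
qed

text \<open>Kruskal's algorithm on \<open>F\<close>: an edge enters \<open>D\<close> only if its
  ends still carry different labels, and then a label disappears. This pays for the edge in the
  bound on \<open>card D\<close>.\<close>

lemma spans_merge_edges:
  fixes f :: "'a \<Rightarrow> 'b"
  assumes "finite F" "spans T S f" "finite S"
  shows "\<exists>D (g :: 'b \<Rightarrow> 'b). D \<subseteq> F \<and> spans (T \<union> D) S (g \<circ> f) \<and>
    card D + card ((g \<circ> f) ` S) \<le> card (f ` S) \<and>
    (\<forall>x\<in>S. \<forall>y\<in>S. {x, y} \<in> F \<longrightarrow> g (f x) = g (f y))"
  using assms(1)
proof (induction F rule: finite_induct)
  case empty
  show ?case using assms(2) by (intro exI[of _ "{}"] exI[of _ id]) simp
next
  case (insert e F)
  then obtain D and g :: "'b \<Rightarrow> 'b" where Dg: "D \<subseteq> F" "spans (T \<union> D) S (g \<circ> f)"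
    "card D + card ((g \<circ> f) ` S) \<le> card (f ` S)"
    "\<And>x y. x \<in> S \<Longrightarrow> y \<in> S \<Longrightarrow> {x, y} \<in> F \<Longrightarrow> g (f x) = g (f y)"
    by blast
  show ?case
  proof (cases "\<exists>x\<in>S. \<exists>y\<in>S. e = {x, y} \<and> g (f x) \<noteq> g (f y)")
    case False
    with Dg show ?thesis by (intro exI[of _ D] exI[of _ g]) blast
  next
    case True
    then obtain x y where xy: "x \<in> S" "y \<in> S" "e = {x, y}" "g (f x) \<noteq> g (f y)" by blast
    define h where "h = (\<lambda>z. if z = g (f y) then g (f x) else z)"
    have "spans (insert {x, y} (T \<union> D)) S (h \<circ> (g \<circ> f))"
      using spans_merge_edge[OF Dg(2) xy(1,2)] by (simp only: h_def comp_apply)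
    then have sp: "spans (T \<union> insert e D) S ((h \<circ> g) \<circ> f)"
      using xy(3) by (simp add: comp_assoc)
    have "((h \<circ> g) \<circ> f) ` S \<subseteq> (g \<circ> f) ` S - {(g \<circ> f) y}"
      using xy by (auto simp: h_def)
    then have "card (((h \<circ> g) \<circ> f) ` S) \<le> card ((g \<circ> f) ` S - {(g \<circ> f) y})"
      using assms(3) by (intro card_mono) auto
    also have "\<dots> = card ((g \<circ> f) ` S) - 1"
      using xy(2) by (intro card_Diff_singleton) blast
    finally have "card (((h \<circ> g) \<circ> f) ` S) \<le> card ((g \<circ> f) ` S) - 1" .
    moreover have "card ((g \<circ> f) ` S) > 0"
      using xy(1) assms(3) by (auto simp: card_gt_0_iff)
    moreover have "card (insert e D) \<le> Suc (card D)" by (rule card_insert_le_m1) auto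
    ultimately have "card (insert e D) + card (((h \<circ> g) \<circ> f) ` S) \<le> card (f ` S)"
      using Dg(3) by linarith
    moreover have "(h \<circ> g) (f u) = (h \<circ> g) (f w)" if "u \<in> S" "w \<in> S" "{u, w} \<in> insert e F" for u w
      using that Dg(4)[of u w] xy by (auto simp: h_def doubleton_eq_iff)
    ultimately show ?thesis
      using sp Dg(1) by (intro exI[of _ "insert e D"] exI[of _ "h \<circ> g"]) blast
  qed
qed

text \<open>A fibre that meets \<open>H\<close> has at least two elements, so in every fibre twice
  its size is at least 2 plus its number of elements of \<open>H\<close>. Summing over the fibres
  gives the claim.\<close>

lemma card_image_collisions:
  assumes "finite B" "H \<subseteq> B" "\<And>a. a \<in> H \<Longrightarrow> \<exists>b\<in>B. b \<noteq> a \<and> g b = g a"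
  shows "2 * card (g ` B) + card H \<le> 2 * card B"
proof -
  let ?fib = "\<lambda>U y. {a \<in> U. g a = y}"
  have fibs: "card U = (\<Sum>y\<in>g ` B. card (?fib U y))" if "U \<subseteq> B" for U
  proof -
    have "finite U" using that assms(1) by (rule finite_subset)
    then have "card (\<Union>y\<in>g ` B. ?fib U y) = (\<Sum>y\<in>g ` B. card (?fib U y))"
      using assms(1) by (intro card_UN_disjoint) auto
    moreover have "(\<Union>y\<in>g ` B. ?fib U y) = U" using that by auto
    ultimately show ?thesis by simp
  qed
  have "2 + card (?fib H y) \<le> 2 * card (?fib B y)" if "y \<in> g ` B" for y
  proof -
    have le: "card (?fib H y) \<le> card (?fib B y)"
      using assms(1,2) by (intro card_mono) auto
    show ?thesis
    proof (cases "?fib H y = {}")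
      case True
      then have "card (?fib H y) = 0" by (simp only: card.empty)
      moreover have "card (?fib B y) > 0" using that assms(1) by (auto simp: card_gt_0_iff)
      ultimately show ?thesis by linarith
    next
      case False
      then obtain a b where "a \<in> ?fib B y" "b \<in> ?fib B y" "a \<noteq> b"
        using assms(2,3) by blast
      then have "card {a, b} \<le> card (?fib B y)" using assms(1) by (intro card_mono) auto
      then show ?thesis using le \<open>a \<noteq> b\<close> by simp
    qed
  qed
  then have "(\<Sum>y\<in>g ` B. 2 + card (?fib H y)) \<le> (\<Sum>y\<in>g ` B. 2 * card (?fib B y))"
    by (rule sum_mono)
  then show ?thesis
    unfolding sum.distrib sum_distrib_left[symmetric] fibs[OF assms(2), symmetric]
      fibs[OF order.refl, symmetric] by simp
qed

text \<open>Double counting of pairs of a component and a colour on its boundary. With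
  \<open>m\<close> components there are at least \<open>l * card S * (m - 1)\<close> pairs, because
  the component sizes add up to \<open>card S\<close>. So one of the at most
  \<open>Q * l * card S\<close> colours touches at least \<open>(m - 1) / Q\<close> components. Each
  of these is merged with another one, which removes at least half that number.\<close>

lemma color_merging_components:
  fixes f :: "'a \<Rightarrow> 'b" and Q l :: real
  assumes proper: "properly_colored E col" and "finite E" and "finite S" "S \<noteq> {}"
    and A: "finite A" "A \<noteq> {}" "real (card A) \<le> Q * l * real (card S)"
    and "l > 0" "Q > 0"
    and exp: "edge_expander l S (induced_colored_edges E col S A)"
    and spans: "spans T S f"
  shows "\<exists>c\<in>A. \<exists>D (f' :: 'a \<Rightarrow> 'b). D \<subseteq> {e \<in> E. e \<subseteq> S \<and> col e = c} \<and> spans (T \<union> D) S f' \<and>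
    card D + card (f' ` S) \<le> card (f ` S) \<and>
    real (card (f' ` S)) - 1 \<le> (1 - 1 / (2 * Q)) * (real (card (f ` S)) - 1)"
proof -
  let ?B = "f ` S"
  let ?n = "real (card S)" and ?m = "real (card ?B)"
  define X where "X a = {x \<in> S. f x = a}" for a
  define R where "R a c \<longleftrightarrow> (\<exists>x\<in>X a. \<exists>y\<in>S - X a. {x, y} \<in> E \<and> col {x, y} = c)" for a c
  have "card (\<Union>a\<in>?B. X a) = (\<Sum>a\<in>?B. card (X a))"
    using assms(3) by (intro card_UN_disjoint) (auto simp: X_def)
  moreover have "(\<Union>a\<in>?B. X a) = S" by (auto simp: X_def)
  ultimately have cardS: "(\<Sum>a\<in>?B. real (card (X a))) = ?n" by simp
  have "l * ?n * (?m - 1) = (\<Sum>a\<in>?B. l * (?n - real (card (X a))))"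
    unfolding sum_distrib_left[symmetric] sum_subtractf cardS by (simp add: algebra_simps)
  also have "\<dots> \<le> (\<Sum>a\<in>?B. real (card {c \<in> A. R a c}))"
    unfolding R_def
    by (intro sum_mono boundary_colors_of_expander proper assms(3) A(1) exp) (auto simp: X_def)
  also have "\<dots> = real (\<Sum>a\<in>?B. card {c \<in> A. R a c})" by simp
  also have "(\<Sum>a\<in>?B. card {c \<in> A. R a c}) = (\<Sum>c\<in>A. card {a \<in> ?B. R a c})"
    using sum_multicount_gen[of ?B A R "\<lambda>c. card {a \<in> ?B. R a c}"] assms(3) A(1) by simp
  finally have total: "l * ?n * (?m - 1) \<le> (\<Sum>c\<in>A. real (card {a \<in> ?B. R a c}))" by simp
  have "\<exists>c\<in>A. ?m - 1 \<le> Q * real (card {a \<in> ?B. R a c})"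
  proof (rule ccontr)
    assume "\<not> ?thesis"
    then have less: "real (card {a \<in> ?B. R a c}) < (?m - 1) / Q" if "c \<in> A" for c
      using that \<open>Q > 0\<close> by (auto simp: pos_less_divide_eq mult_ac not_le)
    have "?m \<ge> 1" using assms(3,4) by (simp add: Suc_le_eq card_gt_0_iff)
    have "(\<Sum>c\<in>A. real (card {a \<in> ?B. R a c})) < (\<Sum>c\<in>A. (?m - 1) / Q)"
      using A less by (intro sum_strict_mono) auto
    also have "\<dots> = real (card A) * ((?m - 1) / Q)" by simp
    also have "\<dots> \<le> (Q * l * ?n) * ((?m - 1) / Q)"
      using A(3) \<open>?m \<ge> 1\<close> \<open>Q > 0\<close> by (intro mult_right_mono) auto
    also have "\<dots> = l * ?n * (?m - 1)" using \<open>Q > 0\<close> by simp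
    finally show False using total by simp
  qed
  then obtain c where c: "c \<in> A" "?m - 1 \<le> Q * real (card {a \<in> ?B. R a c})" by blast
  let ?F = "{e \<in> E. e \<subseteq> S \<and> col e = c}"
  have "finite ?F" using assms(2) by simp
  from spans_merge_edges[OF this spans assms(3)] obtain D and g :: "'b \<Rightarrow> 'b" where
    D: "D \<subseteq> ?F" "spans (T \<union> D) S (g \<circ> f)" "card D + card ((g \<circ> f) ` S) \<le> card ?B" and
    g: "\<And>x y. x \<in> S \<Longrightarrow> y \<in> S \<Longrightarrow> {x, y} \<in> ?F \<Longrightarrow> g (f x) = g (f y)"
    by blast
  have "2 * card (g ` ?B) + card {a \<in> ?B. R a c} \<le> 2 * card ?B"
  proof (rule card_image_collisions)
    fix a assume "a \<in> {a \<in> ?B. R a c}"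
    then obtain x y where "x \<in> S" "f x = a" "y \<in> S" "f y \<noteq> a" "{x, y} \<in> E" "col {x, y} = c"
      by (auto simp: R_def X_def)
    then show "\<exists>b\<in>?B. b \<noteq> a \<and> g b = g a" using g[of x y] by (intro bexI[of _ "f y"]) auto
  qed (use assms(3) in auto)
  then have "2 * real (card ((g \<circ> f) ` S)) + real (card {a \<in> ?B. R a c}) \<le> 2 * ?m"
    unfolding image_comp by linarith
  moreover have "(?m - 1) / Q \<le> real (card {a \<in> ?B. R a c})"
    using c(2) \<open>Q > 0\<close> by (simp add: pos_divide_le_eq mult_ac)
  moreover have "(1 - 1 / (2 * Q)) * (?m - 1) = ?m - 1 - (?m - 1) / Q / 2"
    by (simp add: algebra_simps)
  ultimately have "real (card ((g \<circ> f) ` S)) - 1 \<le> (1 - 1 / (2 * Q)) * (?m - 1)"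
    by argo
  then show ?thesis using c(1) D by blast
qed

text \<open>The last inequality is a potential argument: an edge \<open>e\<close> added in round \<open>J e\<close> costs \<open>J e + 1\<close>, and
  merging components in a round pays for the growth of the factor \<open>i + 2 * Q\<close>.\<close>

lemma greedy_spanning_forest:
  fixes Q l :: real
  assumes proper: "properly_colored E col" and "finite E" and "finite S" "S \<noteq> {}"
    and A: "finite A" "A \<noteq> {}" "real (card A) \<le> Q * l * real (card S)"
    and "l > 0" "Q \<ge> 1 / 2"
    and exp: "edge_expander l S (induced_colored_edges E col S A)"
  shows "\<exists>cs T (f :: 'a \<Rightarrow> 'a) J. length cs = i \<and> set cs \<subseteq> A \<and> T \<subseteq> E \<and> (\<forall>e\<in>T. e \<subseteq> S) \<and> spans T S f \<and>
    card T + card (f ` S) \<le> card S \<and>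
    real (card (f ` S)) - 1 \<le> (1 - 1 / (2 * Q)) ^ i * (real (card S) - 1) \<and>
    (\<forall>e\<in>T. J e < i \<and> cs ! J e = col e) \<and>
    real (\<Sum>e\<in>T. J e + 1) + (real (card (f ` S)) - 1) * (real i + 2 * Q) \<le> 2 * Q * (real (card S) - 1)"
proof (induction i)
  case 0
  show ?case
    by (intro exI[of _ "[]"] exI[of _ "{}"] exI[of _ id] exI[of _ "\<lambda>_. 0"]) (simp add: spans_def)
next
  case (Suc i)
  then obtain cs T and f :: "'a \<Rightarrow> 'a" and J where
    cs: "length cs = i" "set cs \<subseteq> A" and T: "T \<subseteq> E" "\<forall>e\<in>T. e \<subseteq> S" "spans T S f"
    "card T + card (f ` S) \<le> card S" and
    m: "real (card (f ` S)) - 1 \<le> (1 - 1 / (2 * Q)) ^ i * (real (card S) - 1)" and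
    J: "\<forall>e\<in>T. J e < i \<and> cs ! J e = col e" and
    pot: "real (\<Sum>e\<in>T. J e + 1) + (real (card (f ` S)) - 1) * (real i + 2 * Q) \<le> 2 * Q * (real (card S) - 1)"
    by blast
  have Q: "Q > 0" using assms by simp
  obtain c D and f' :: "'a \<Rightarrow> 'a" where c: "c \<in> A" and
    D: "D \<subseteq> {e \<in> E. e \<subseteq> S \<and> col e = c}" "spans (T \<union> D) S f'" "card D + card (f' ` S) \<le> card (f ` S)"
    and m': "real (card (f' ` S)) - 1 \<le> (1 - 1 / (2 * Q)) * (real (card (f ` S)) - 1)"
    using color_merging_components[OF proper assms(2-4) A assms(8) Q exp T(3)] by blast
  have fin: "finite T" "finite D" using T(1) D(1) assms(2) by (auto intro: finite_subset)
  \<comment> \<open>An edge already in \<open>T\<close> keeps its earlier round, so only the edges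
    of \<open>D - T\<close> are charged \<open>i + 1\<close>.\<close>
  define J' where "J' e = (if e \<in> T then J e else i)" for e
  \<comment> \<open>Iterating the shrinkage needs a nonnegative factor, which is where
    \<open>Q \<ge> 1 / 2\<close> enters.\<close>
  have "(1 - 1 / (2 * Q)) * (real (card (f ` S)) - 1)
      \<le> (1 - 1 / (2 * Q)) * ((1 - 1 / (2 * Q)) ^ i * (real (card S) - 1))"
    using assms(9) m by (intro mult_left_mono) (auto simp: field_simps)
  then have shrink: "real (card (f' ` S)) - 1 \<le> (1 - 1 / (2 * Q)) ^ Suc i * (real (card S) - 1)"
    using m' by simp
  have "(\<Sum>e\<in>T \<union> D. J' e + 1) = (\<Sum>e\<in>T. J' e + 1) + (\<Sum>e\<in>D - T. J' e + 1)"
    using fin by (subst sum.union_disjoint[symmetric]) auto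
  also have "\<dots> = (\<Sum>e\<in>T. J e + 1) + card (D - T) * (i + 1)"
    by (simp add: J'_def)
  also have "\<dots> \<le> (\<Sum>e\<in>T. J e + 1) + (card (f ` S) - card (f' ` S)) * (i + 1)"
    using D(3) card_mono[of D "D - T"] fin by (intro add_left_mono mult_right_mono) auto
  finally have "real (\<Sum>e\<in>T \<union> D. J' e + 1)
      \<le> real ((\<Sum>e\<in>T. J e + 1) + (card (f ` S) - card (f' ` S)) * (i + 1))"
    by (simp only: of_nat_le_iff)
  also have "\<dots> = real (\<Sum>e\<in>T. J e + 1) + (real (card (f ` S)) - real (card (f' ` S))) * (real i + 1)"
    using D(3) by (simp only: of_nat_add of_nat_mult of_nat_1) (subst of_nat_diff, auto)
  finally have cost: "real (\<Sum>e\<in>T \<union> D. J' e + 1)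
    \<le> real (\<Sum>e\<in>T. J e + 1) + (real (card (f ` S)) - real (card (f' ` S))) * (real i + 1)" .
  \<comment> \<open>Let \<open>m\<close> and \<open>m'\<close> count the components before and
    after. The new edges cost at most \<open>(m - m') * (i + 1)\<close>, which together with
    \<open>(m' - 1) * (i + 1)\<close> makes \<open>(m - 1) * (i + 1)\<close>. This exceeds the old
    term \<open>(m - 1) * i\<close> by \<open>m - 1\<close>, and the part of the potential with
    factor \<open>2 * Q\<close> drops by at least as much.\<close>
  have "2 * Q * (real (card (f' ` S)) - 1) \<le> 2 * Q * ((1 - 1 / (2 * Q)) * (real (card (f ` S)) - 1))"
    using m' Q by (intro mult_left_mono) auto
  also have "\<dots> = 2 * Q * (real (card (f ` S)) - 1) - (real (card (f ` S)) - 1)"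
    using Q by (simp add: field_simps)
  finally have "real (\<Sum>e\<in>T \<union> D. J' e + 1) + (real (card (f' ` S)) - 1) * (real (Suc i) + 2 * Q)
    \<le> 2 * Q * (real (card S) - 1)"
    using cost pot by (simp add: algebra_simps)
  moreover have "\<forall>e\<in>T \<union> D. J' e < Suc i \<and> (cs @ [c]) ! J' e = col e"
    using J D(1) cs(1) by (auto simp: J'_def nth_append)
  moreover have "card (T \<union> D) + card (f' ` S) \<le> card S"
    using card_Un_le[of T D] D(3) T(4) by linarith
  ultimately show ?case
    using shrink cs c T(1,2) D(1,2)
    by (intro exI[of _ "cs @ [c]"] exI[of _ "T \<union> D"] exI[of _ f'] exI[of _ J']) auto
qed

section \<open>Bond percolation and disjoint cluster events\<close>

text \<open>The union bound for independent events of probabilities \<open>p a\<close>, in product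
  form.\<close>

lemma prod_one_minus_ge:
  fixes p :: "'a \<Rightarrow> real"
  assumes "finite A" "\<And>a. a \<in> A \<Longrightarrow> 0 \<le> p a" "\<And>a. a \<in> A \<Longrightarrow> p a \<le> 1"
  shows "1 - (\<Sum>a\<in>A. p a) \<le> (\<Prod>a\<in>A. 1 - p a)"
  using assms
proof (induction A rule: finite_induct)
  case (insert x A)
  have "0 \<le> (\<Prod>a\<in>A. 1 - p a)" "(\<Prod>a\<in>A. 1 - p a) \<le> 1"
    using insert.prems by (auto intro!: prod_nonneg prod_le_1)
  then have "p x * (\<Prod>a\<in>A. 1 - p a) \<le> p x"
    using insert.prems(1)[of x] by (simp add: mult_left_le)
  moreover have "1 - (\<Sum>a\<in>A. p a) \<le> (\<Prod>a\<in>A. 1 - p a)" using insert by simp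
  ultimately show ?case using insert.hyps by (simp add: algebra_simps)
qed simp

text \<open>In bond percolation with edge probabilities \<open>p\<close>, this is the probability that all edges of
  \<open>A\<close> are open and all edges of \<open>B\<close> are closed.\<close>

lemma percolation_event_weight:
  fixes p :: "'e \<Rightarrow> real"
  assumes "finite E" "A \<subseteq> E" "B \<subseteq> E" "A \<inter> B = {}"
  shows "(\<Sum>F | A \<subseteq> F \<and> F \<subseteq> E - B. (\<Prod>e\<in>F. p e) * (\<Prod>e\<in>E - F. 1 - p e))
    = (\<Prod>e\<in>A. p e) * (\<Prod>e\<in>B. 1 - p e)"
proof -
  let ?R = "E - A - B"
  have fin: "finite A" "finite B" "finite ?R" using assms finite_subset by blast+
  \<comment> \<open>The edges outside \<open>A\<close> and \<open>B\<close> are free: a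
    configuration in the event is \<open>A\<close> together with an arbitrary \<open>G\<close>, and
    the weights of all \<open>G\<close> sum to 1.\<close>
  have bij: "bij_betw (\<lambda>G. A \<union> G) (Pow ?R) {F. A \<subseteq> F \<and> F \<subseteq> E - B}"
    by (rule bij_betw_byWitness[where f' = "\<lambda>F. F - A"]) (use assms in auto)
  have "(\<Prod>e\<in>A \<union> G. p e) * (\<Prod>e\<in>E - (A \<union> G). 1 - p e)
      = ((\<Prod>e\<in>A. p e) * (\<Prod>e\<in>B. 1 - p e)) * ((\<Prod>e\<in>G. p e) * (\<Prod>e\<in>?R - G. 1 - p e))"
    if "G \<in> Pow ?R" for G
  proof -
    have "finite G" using that fin by (auto intro: finite_subset)
    then have "(\<Prod>e\<in>A \<union> G. p e) = (\<Prod>e\<in>A. p e) * (\<Prod>e\<in>G. p e)"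
      using that fin by (intro prod.union_disjoint) auto
    moreover have "E - (A \<union> G) = B \<union> (?R - G)" using that assms by auto
    moreover have "(\<Prod>e\<in>B \<union> (?R - G). 1 - p e) = (\<Prod>e\<in>B. 1 - p e) * (\<Prod>e\<in>?R - G. 1 - p e)"
      using fin by (intro prod.union_disjoint) auto
    ultimately show ?thesis by (simp only: mult_ac)
  qed
  then have "(\<Sum>F | A \<subseteq> F \<and> F \<subseteq> E - B. (\<Prod>e\<in>F. p e) * (\<Prod>e\<in>E - F. 1 - p e))
      = (\<Sum>G\<in>Pow ?R. ((\<Prod>e\<in>A. p e) * (\<Prod>e\<in>B. 1 - p e)) * ((\<Prod>e\<in>G. p e) * (\<Prod>e\<in>?R - G. 1 - p e)))"
    unfolding sum.reindex_bij_betw[OF bij, symmetric] by (rule sum.cong[OF refl])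
  also have "\<dots> = ((\<Prod>e\<in>A. p e) * (\<Prod>e\<in>B. 1 - p e)) * (\<Prod>e\<in>?R. p e + (1 - p e))"
    unfolding sum_distrib_left[symmetric] prod_add[OF fin(3), symmetric] ..
  finally show ?thesis by simp
qed

definition cut_connected :: "'a set set \<Rightarrow> 'a set \<Rightarrow> bool" where
  "cut_connected T S \<longleftrightarrow> (\<forall>X\<subseteq>S. X \<noteq> {} \<longrightarrow> X \<noteq> S \<longrightarrow> (\<exists>x\<in>X. \<exists>y\<in>S - X. {x, y} \<in> T))"

text \<open>Group the boundary edges by their endpoint in \<open>S\<close>. Edges at one vertex have
  distinct colours, so their weights sum to at most \<open>1 / 2\<close>, and all of them are closed
  with probability at least \<open>1 / 2\<close>.\<close>

lemma boundary_closed_prob_ge: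
  fixes w :: "'c \<Rightarrow> real"
  assumes graph: "simple_graph V E" and proper: "properly_colored E col" and "S \<subseteq> V"
    and w: "\<And>c. 0 \<le> w c" "sum w (col ` E) \<le> 1 / 2"
  shows "(1 / 2) ^ card S \<le> (\<Prod>e\<in>edges_between E S (V - S). 1 - w (col e))"
proof -
  let ?B = "edges_between E S (V - S)"
  have fin: "finite E" "finite S"
    using graph assms(3) finite_subset[of E "Pow V"] finite_subset[of S V]
    by (auto simp: simple_graph_def)
  have BE: "?B \<subseteq> E" by (auto simp: edges_between_def)
  have Bun: "?B = (\<Union>x\<in>S. {e \<in> ?B. x \<in> e})" by (auto simp: edges_between_def)
  have "(\<Prod>e\<in>(\<Union>x\<in>S. {e \<in> ?B. x \<in> e}). 1 - w (col e))
      = (\<Prod>x\<in>S. \<Prod>e\<in>{e \<in> ?B. x \<in> e}. 1 - w (col e))"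
    using fin BE by (intro prod.UNION_disjoint) (auto intro: finite_subset simp: edges_between_def)
  then have split: "(\<Prod>e\<in>?B. 1 - w (col e)) = (\<Prod>x\<in>S. \<Prod>e\<in>{e \<in> ?B. x \<in> e}. 1 - w (col e))"
    using Bun by simp
  have "1 / 2 \<le> (\<Prod>e\<in>{e \<in> ?B. x \<in> e}. 1 - w (col e))" for x
  proof -
    let ?Bx = "{e \<in> ?B. x \<in> e}"
    have finx: "finite ?Bx" using fin BE by (auto intro: finite_subset)
    have "inj_on col ?Bx"
      by (rule inj_onI, rule properly_coloredD[OF proper, of _ _ x]) (use BE in auto)
    then have "(\<Sum>e\<in>?Bx. w (col e)) = sum w (col ` ?Bx)" by (simp add: sum.reindex)
    also have "\<dots> \<le> sum w (col ` E)" using fin BE w(1) by (intro sum_mono2) auto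
    finally have le: "(\<Sum>e\<in>?Bx. w (col e)) \<le> 1 / 2" using w(2) by simp
    have "w (col e) \<le> 1" if "e \<in> ?Bx" for e
      using member_le_sum[of e ?Bx "\<lambda>e. w (col e)"] that finx w(1) le by force
    then show ?thesis using prod_one_minus_ge[of ?Bx "\<lambda>e. w (col e)"] finx w(1) le by force
  qed
  then have "(\<Prod>x\<in>S. 1 / 2 :: real) \<le> (\<Prod>x\<in>S. \<Prod>e\<in>{e \<in> ?B. x \<in> e}. 1 - w (col e))"
    by (intro prod_mono) auto
  then show ?thesis unfolding split by simp
qed

text \<open>The event \<open>?ev S\<close> in the proof says that \<open>S\<close> is the open cluster of \<open>v\<close>, witnessed by the open edges
  \<open>T\<close>. These events are disjoint for distinct \<open>S\<close>, and each of them has probability at least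
  \<open>b / 2 ^ n\<close>.\<close>

lemma card_clusters_le:
  fixes w :: "'c \<Rightarrow> real"
  assumes graph: "simple_graph V E" and proper: "properly_colored E col"
    and w: "\<And>c. 0 \<le> w c" "sum w (col ` E) \<le> 1 / 2" and "b \<ge> 0"
    and \<S>: "\<And>S. S \<in> \<S> \<Longrightarrow> S \<subseteq> V \<and> v \<in> S \<and> card S = n \<and>
      (\<exists>T\<subseteq>E. (\<forall>e\<in>T. e \<subseteq> S) \<and> cut_connected T S \<and> b \<le> (\<Prod>e\<in>T. w (col e)))"
  shows "real (card \<S>) * (b * (1 / 2) ^ n) \<le> 1"
proof -
  have fin: "finite V" "finite E"
    using graph finite_subset[of E "Pow V"] by (auto simp: simple_graph_def)
  have "finite \<S>" using \<S> fin(1) finite_subset[of \<S> "Pow V"] by blast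
  obtain T where T: "\<And>S. S \<in> \<S> \<Longrightarrow> T S \<subseteq> E \<and> (\<forall>e\<in>T S. e \<subseteq> S) \<and> cut_connected (T S) S \<and>
      b \<le> (\<Prod>e\<in>T S. w (col e))"
    using \<S> by metis
  let ?B = "\<lambda>S. edges_between E S (V - S)"
  let ?ev = "\<lambda>S. {F. T S \<subseteq> F \<and> F \<subseteq> E - ?B S}"
  let ?P = "\<lambda>F. (\<Prod>e\<in>F. w (col e)) * (\<Prod>e\<in>E - F. 1 - w (col e))"
  have w1: "w (col e) \<le> 1" if "e \<in> E" for e
    using member_le_sum[of "col e" "col ` E" w] that fin w by force
  have P0: "?P F \<ge> 0" if "F \<subseteq> E" for F
    using w(1) w1 that by (intro mult_nonneg_nonneg prod_nonneg) auto
  have sub: "S \<subseteq> S'" if S: "S \<in> \<S>" "S' \<in> \<S>" "F \<in> ?ev S" "F \<in> ?ev S'" for S S' F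
  proof (rule ccontr)
    assume "\<not> S \<subseteq> S'"
    moreover have "v \<in> S \<inter> S'" using \<S> S by blast
    \<comment> \<open>Connectedness is applied to the cut of \<open>S\<close> along its intersection
      with \<open>S'\<close>, nonempty thanks to \<open>v\<close>. The crossing edge of
      \<open>T S\<close> is open in \<open>F\<close>, yet it lies on the boundary of
      \<open>S'\<close>, where all edges are closed.\<close>
    ultimately obtain x y where xy: "x \<in> S \<inter> S'" "y \<in> S - S \<inter> S'" "{x, y} \<in> T S"
      using T[OF S(1)] unfolding cut_connected_def by (metis Int_lower1 Int_absorb1 empty_iff inf.absorb_iff1)
    have "{x, y} \<in> E" "y \<in> V - S'" using T[OF S(1)] \<S>[OF S(1)] xy by auto
    then have "{x, y} \<in> ?B S'" using xy(1) unfolding edges_between_def by blast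
    then show False using S(3,4) xy(3) by blast
  qed
  have low: "b * (1 / 2) ^ n \<le> sum ?P (?ev S)" if "S \<in> \<S>" for S
  proof -
    have "T S \<inter> ?B S = {}"
      using T[OF that] by (auto simp: edges_between_def)
    then have "sum ?P (?ev S) = (\<Prod>e\<in>T S. w (col e)) * (\<Prod>e\<in>?B S. 1 - w (col e))"
      using T[OF that] fin(2) by (intro percolation_event_weight) (auto simp: edges_between_def)
    moreover have "(1 / 2) ^ n \<le> (\<Prod>e\<in>?B S. 1 - w (col e))"
      using boundary_closed_prob_ge[OF graph proper _ w, of S] \<S>[OF that] by auto
    ultimately show ?thesis
      using T[OF that] \<open>b \<ge> 0\<close> w(1) by (auto intro!: mult_mono prod_nonneg)
  qed
  have "real (card \<S>) * (b * (1 / 2) ^ n) = (\<Sum>S\<in>\<S>. b * (1 / 2) ^ n)" by simp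
  also have "\<dots> \<le> (\<Sum>S\<in>\<S>. sum ?P (?ev S))" by (intro sum_mono low)
  also have "\<dots> = sum ?P (\<Union>S\<in>\<S>. ?ev S)"
  proof (rule sum.UNION_disjoint[symmetric])
    show "\<forall>S\<in>\<S>. finite (?ev S)" using fin(2) by (auto intro: finite_subset[of _ "Pow E"])
    show "\<forall>S\<in>\<S>. \<forall>S'\<in>\<S>. S \<noteq> S' \<longrightarrow> ?ev S \<inter> ?ev S' = {}"
    proof (intro ballI impI equals0I)
      fix S S' F assume "S \<in> \<S>" "S' \<in> \<S>" "S \<noteq> S'" "F \<in> ?ev S \<inter> ?ev S'"
      then show False using sub[of S S' F] sub[of S' S F] by blast
    qed
  qed fact
  \<comment> \<open>The sum over all configurations is the total probability, which is 1.\<close>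
  also have "\<dots> \<le> sum ?P (Pow E)"
    using fin(2) P0 by (intro sum_mono2) auto
  also have "\<dots> = (\<Prod>e\<in>E. w (col e) + (1 - w (col e)))"
    by (rule prod_add[OF fin(2), symmetric])
  finally show ?thesis by simp
qed

section \<open>Edge probabilities from the rounds of a colour sequence\<close>

definition round_weight :: "real \<Rightarrow> nat \<Rightarrow> real" where
  "round_weight Q j = exp (- (real (j + 1) / (2 * Q))) / (4 * Q)"

text \<open>A sum, so that repetitions in \<open>cs\<close> do no harm: a colour is at least as likely as each of its
  rounds, and the total weight is bounded by that of all rounds.\<close>

definition color_weight :: "real \<Rightarrow> 'c list \<Rightarrow> 'c \<Rightarrow> real" where
  "color_weight Q cs c = (\<Sum>j | j < length cs \<and> cs ! j = c. round_weight Q j)"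

lemma round_weight_pos: "Q > 0 \<Longrightarrow> round_weight Q j > 0"
  by (simp add: round_weight_def)

text \<open>A geometric series with ratio \<open>x = exp (- (1 / (2 * Q)))\<close>. From
  \<open>exp y \<ge> 1 + y\<close> follows \<open>x \<le> 2 * Q * (1 - x)\<close>, so the powers of
  \<open>x\<close> sum to at most \<open>2 * Q\<close>, and the normalisation \<open>4 * Q\<close>
  leaves one half.\<close>

lemma sum_round_weight_le:
  assumes "Q > 0"
  shows "(\<Sum>j<t. round_weight Q j) \<le> 1 / 2"
proof -
  define x where "x = exp (- (1 / (2 * Q)))"
  have "x * (1 + 1 / (2 * Q)) \<le> x * exp (1 / (2 * Q))"
    using exp_ge_add_one_self by (intro mult_left_mono) (auto simp: x_def)
  also have "\<dots> = 1" by (simp add: x_def exp_minus)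
  finally have x: "x \<le> 2 * Q * (1 - x)" using assms by (simp add: field_simps)
  have "(\<Sum>j<t. x ^ (j + 1)) \<le> 2 * Q * (1 - x ^ t)"
  proof (induction t)
    case (Suc t)
    have "x ^ t * x \<le> x ^ t * (2 * Q * (1 - x))"
      using x by (intro mult_left_mono) (auto simp: x_def)
    then show ?case using Suc by (simp add: algebra_simps)
  qed simp
  also have "\<dots> \<le> 2 * Q" using assms by (simp add: x_def)
  finally have "(\<Sum>j<t. x ^ (j + 1)) / (4 * Q) \<le> 1 / 2" using assms by (simp add: field_simps)
  moreover have "round_weight Q j = x ^ (j + 1) / (4 * Q)" for j
    unfolding round_weight_def x_def exp_of_nat_mult[symmetric] by simp
  ultimately show ?thesis by (simp only: sum_divide_distrib)
qed

lemma color_weight_nonneg: "Q > 0 \<Longrightarrow> color_weight Q cs c \<ge> 0"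
  unfolding color_weight_def by (intro sum_nonneg) (simp add: round_weight_pos less_imp_le)

lemma round_weight_le_color_weight:
  assumes "Q > 0" "j < length cs" "cs ! j = c"
  shows "round_weight Q j \<le> color_weight Q cs c"
  unfolding color_weight_def
  by (rule member_le_sum) (use assms in \<open>auto simp: round_weight_pos less_imp_le\<close>)

lemma sum_color_weight_le:
  assumes "Q > 0" "finite C"
  shows "sum (color_weight Q cs) C \<le> 1 / 2"
proof -
  have "sum (color_weight Q cs) C
      = sum (round_weight Q) (\<Union>c\<in>C. {j. j < length cs \<and> cs ! j = c})"
    unfolding color_weight_def using assms(2) by (intro sum.UNION_disjoint[symmetric]) auto
  also have "\<dots> \<le> sum (round_weight Q) {..<length cs}"
    using assms(1) by (intro sum_mono2) (auto simp: round_weight_pos less_imp_le)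
  finally show ?thesis using sum_round_weight_le[OF assms(1)] by (meson order.trans)
qed

section \<open>Counting expanding sets\<close>

text \<open>Bounds the number of colours in use, and with it the number of colour sequences.\<close>

lemma card_edges_le_square:
  assumes "simple_graph V E"
  shows "card E \<le> card V ^ 2"
proof -
  have "E \<subseteq> (\<lambda>(x, y). {x, y}) ` (V \<times> V)"
  proof
    fix e assume "e \<in> E"
    then show "e \<in> (\<lambda>(x, y). {x, y}) ` (V \<times> V)"
      using assms by (fastforce simp: simple_graph_def card_2_iff)
  qed
  then have "card E \<le> card (V \<times> V)"
    using assms by (intro surj_card_le) (auto simp: simple_graph_def)
  then show ?thesis by (simp add: card_cartesian_product power2_eq_square)
qed

text \<open>What the percolation argument retains of the greedy construction: few edges, and a total
  of rounds small enough that the exponential weights lose only a factor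
  \<open>exp (- card S)\<close>.\<close>

definition cheaply_connected ::
    "'a set set \<Rightarrow> ('a set \<Rightarrow> 'c) \<Rightarrow> 'c list \<Rightarrow> real \<Rightarrow> 'a set \<Rightarrow> bool" where
  "cheaply_connected E col cs Q S \<longleftrightarrow> (\<exists>T\<subseteq>E. (\<forall>e\<in>T. e \<subseteq> S) \<and> cut_connected T S \<and> card T \<le> card S \<and>
     (\<exists>J. (\<forall>e\<in>T. J e < length cs \<and> cs ! J e = col e) \<and>
        real (\<Sum>e\<in>T. J e + 1) \<le> 2 * Q * real (card S)))"

text \<open>The witness \<open>T\<close> is open with probability at least \<open>b\<close>: the
  total of rounds gives \<open>exp (- n)\<close>, and at most \<open>n\<close> edges give the power
  of \<open>4 * Q\<close>. Closing the boundary costs a further \<open>2 ^ n\<close>, and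
  \<open>8 * exp 1 \<le> 24\<close>.\<close>

lemma card_cheaply_connected_le:
  assumes graph: "simple_graph V E" and proper: "properly_colored E col" and Q: "Q \<ge> 1 / 2"
  shows "real (card {S. S \<subseteq> V \<and> v \<in> S \<and> card S = n \<and> cheaply_connected E col cs Q S}) \<le> (24 * Q) ^ n"
    (is "real (card ?S) \<le> _")
proof -
  define b where "b = exp (- real n) / (4 * Q) ^ n"
  have Q0: "Q > 0" using Q by simp
  have finE: "finite E" using graph finite_subset[of E "Pow V"] by (auto simp: simple_graph_def)
  have "real (card ?S) * (b * (1 / 2) ^ n) \<le> 1"
  proof (rule card_clusters_le[OF graph proper, of "color_weight Q cs" b ?S v n])
    fix S assume "S \<in> ?S"
    then obtain T J where S: "S \<subseteq> V" "v \<in> S" "card S = n" and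
      T: "T \<subseteq> E" "\<forall>e\<in>T. e \<subseteq> S" "cut_connected T S" "card T \<le> card S" and
      J: "\<And>e. e \<in> T \<Longrightarrow> J e < length cs \<and> cs ! J e = col e"
        "real (\<Sum>e\<in>T. J e + 1) \<le> 2 * Q * real (card S)"
      unfolding cheaply_connected_def by blast
    have finT: "finite T" using T(1) finE finite_subset by blast
    have "(4 * Q) ^ card T \<le> (4 * Q) ^ n" using T(4) S(3) Q by (intro power_increasing) auto
    moreover have "real (\<Sum>e\<in>T. J e + 1) / (2 * Q) \<le> real n"
      using J(2) S(3) Q0 by (simp only: pos_divide_le_eq mult_ac)
    ultimately have "b \<le> exp (- (real (\<Sum>e\<in>T. J e + 1) / (2 * Q))) / (4 * Q) ^ card T"
      unfolding b_def using Q0 by (intro frac_le) auto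
    also have "\<dots> = (\<Prod>e\<in>T. round_weight Q (J e))"
      unfolding round_weight_def prod_dividef
      by (simp only: exp_sum[OF finT, symmetric] sum_negf sum_divide_distrib of_nat_sum prod_constant)
    also have "\<dots> \<le> (\<Prod>e\<in>T. color_weight Q cs (col e))"
      using J(1) Q0 by (intro prod_mono) (auto intro!: round_weight_le_color_weight
          simp: round_weight_pos less_imp_le)
    finally show "S \<subseteq> V \<and> v \<in> S \<and> card S = n \<and> (\<exists>T\<subseteq>E. (\<forall>e\<in>T. e \<subseteq> S) \<and> cut_connected T S \<and>
        b \<le> (\<Prod>e\<in>T. color_weight Q cs (col e)))"
      using S T by blast
  next
    show "sum (color_weight Q cs) (col ` E) \<le> 1 / 2"
      using Q0 finE by (intro sum_color_weight_le) auto
  qed (use Q0 in \<open>auto simp: color_weight_nonneg b_def\<close>)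
  then have "real (card ?S) \<le> 1 / (b * (1 / 2) ^ n)"
    using Q0 by (simp add: b_def pos_le_divide_eq)
  also have "b * (1 / 2) ^ n = (exp (- 1) / (4 * Q) * (1 / 2)) ^ n"
    using exp_of_nat_mult[of n "- 1 :: real"]
    by (simp only: b_def power_mult_distrib power_divide mult_minus1_right)
  also have "1 / \<dots> = (1 / (exp (- 1) / (4 * Q) * (1 / 2))) ^ n"
    by (simp only: power_one_over)
  also have "1 / (exp (- 1) / (4 * Q) * (1 / 2)) = exp 1 * (8 * Q)"
    by (simp add: exp_minus inverse_eq_divide)
  also have "(exp 1 * (8 * Q)) ^ n \<le> (24 * Q) ^ n"
    using Q0 exp_le by (intro power_mono) auto
  finally show ?thesis .
qed

text \<open>After \<open>t\<close> rounds the number of components minus one is at most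
  \<open>(card S - 1) / card S < 1\<close>. So a single fibre remains, and a spanning
  \<open>T\<close> with constant labels is connected.\<close>

lemma expander_cheaply_connected:
  assumes proper: "properly_colored E col" and "finite E" "finite S" "card S \<ge> 2"
    and A: "finite A" "A \<noteq> {}" "real (card A) \<le> Q * l * real (card S)"
    and "l > 0" and Q: "Q \<ge> 1 / 2"
    and exp: "edge_expander l S (induced_colored_edges E col S A)"
    and t: "real t \<ge> 2 * Q * ln (real (card S))"
  shows "\<exists>cs. length cs = t \<and> set cs \<subseteq> A \<and> cheaply_connected E col cs Q S"
proof -
  have Q0: "Q > 0" and S0: "S \<noteq> {}" using Q assms(4) by auto
  obtain cs T and f :: "'a \<Rightarrow> 'a" and J where
    cs: "length cs = t" "set cs \<subseteq> A" and T: "T \<subseteq> E" "\<forall>e\<in>T. e \<subseteq> S" "spans T S f"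
    "card T + card (f ` S) \<le> card S" and
    m: "real (card (f ` S)) - 1 \<le> (1 - 1 / (2 * Q)) ^ t * (real (card S) - 1)" and
    J: "\<forall>e\<in>T. J e < t \<and> cs ! J e = col e" and
    pot: "real (\<Sum>e\<in>T. J e + 1) + (real (card (f ` S)) - 1) * (real t + 2 * Q) \<le> 2 * Q * (real (card S) - 1)"
    using greedy_spanning_forest[OF proper assms(2,3) S0 A \<open>l > 0\<close> Q exp, of t] by blast
  have "(1 - 1 / (2 * Q)) ^ t \<le> exp (- (1 / (2 * Q))) ^ t"
    using Q exp_ge_add_one_self[of "- (1 / (2 * Q))"] by (intro power_mono) (auto simp: field_simps)
  also have "\<dots> = exp (- (real t / (2 * Q)))" by (simp add: exp_of_nat_mult[symmetric])
  also have "\<dots> \<le> exp (- ln (real (card S)))"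
    using t Q0 by (simp add: pos_le_divide_eq mult_ac)
  also have "\<dots> = 1 / real (card S)" using assms(4) by (simp add: exp_minus inverse_eq_divide)
  finally have "(1 - 1 / (2 * Q)) ^ t * (real (card S) - 1) \<le> 1 / real (card S) * (real (card S) - 1)"
    using assms(4) by (intro mult_right_mono) auto
  also have "\<dots> < 1" using assms(4) by (simp add: field_simps)
  finally have "card (f ` S) \<le> 1" using m by linarith
  then have const: "f x = f y" if "x \<in> S" "y \<in> S" for x y
    using that assms(3) by (metis card_le_Suc0_iff_eq One_nat_def finite_imageI imageI)
  have "cut_connected T S"
    unfolding cut_connected_def
  proof (intro allI impI)
    fix X assume X: "X \<subseteq> S" "X \<noteq> {}" "X \<noteq> S"
    then obtain x y where "x \<in> X" "y \<in> S - X" by blast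
    with X const[of x y] T(3) show "\<exists>x\<in>X. \<exists>y\<in>S - X. {x, y} \<in> T" unfolding spans_def by blast
  qed
  moreover have "(real (card (f ` S)) - 1) * (real t + 2 * Q) \<ge> 0"
    using S0 assms(3) Q0 by (intro mult_nonneg_nonneg) (auto simp: Suc_le_eq card_gt_0_iff)
  then have "real (\<Sum>e\<in>T. J e + 1) \<le> 2 * Q * real (card S)"
    using pot Q0 by (simp add: algebra_simps)
  ultimately have "cheaply_connected E col cs Q S"
    unfolding cheaply_connected_def using T J cs(1) by (intro exI[of _ T]) auto
  with cs show ?thesis by blast
qed

text \<open>A single vertex already sees at least \<open>l * (card S - 1)\<close> colours, and
  \<open>card S - 1 \<ge> card S / 2\<close>. This provides the lower bound on \<open>Q\<close> that
  the greedy rounds require.\<close>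

lemma expander_color_ratio:
  fixes K l :: real
  assumes "properly_colored E col" "finite S" "card S \<ge> 2" "finite A"
    and "real (card A) \<le> K * real (card S)" "l > 0"
    and "edge_expander l S (induced_colored_edges E col S A)"
  shows "K / l \<ge> 1 / 2"
proof -
  obtain v where v: "v \<in> S" using assms(3) by fastforce
  have "l * (real (card S) / 2) \<le> l * (real (card S) - real (card {v}))"
    using assms(3,6) by (intro mult_left_mono) auto
  also have "\<dots> \<le> real (card {c \<in> A. \<exists>x\<in>{v}. \<exists>y\<in>S - {v}. {x, y} \<in> E \<and> col {x, y} = c})"
    using assms v by (intro boundary_colors_of_expander) auto
  also have "\<dots> \<le> real (card A)" using assms(4) by (simp add: card_mono)
  also have "\<dots> \<le> K * real (card S)" by fact
  finally have "real (card S) * (l / 2) \<le> real (card S) * K" by (simp add: mult_ac)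
  then have "l / 2 \<le> K" using assms(3) by (subst (asm) mult_le_cancel_left_pos) auto
  then show ?thesis using assms(6) by (simp add: field_simps)
qed

text \<open>A union bound over the colour sequence and one vertex of the set: at most
  \<open>N ^ (2 * t + 1)\<close> choices, each accounting for at most \<open>(24 * Q) ^ n\<close>
  sets.\<close>

lemma card_expanding_subsets_properly_colored:
  fixes K l :: real
  assumes graph: "simple_graph V E" and proper: "properly_colored E col" and "l > 0" "n \<ge> 2" "K \<ge> 0"
  defines "Q \<equiv> K / l"
  shows "real (card (expanding_subsets V E col l K n))
    \<le> real (card V) powr (24 * Q * ln (real n)) * (24 * Q) ^ n"
proof (cases "expanding_subsets V E col l K n = {}")
  case True
  show ?thesis using assms(3,5) by (simp add: True Q_def)
next
  case False
  have finV: "finite V" and finE: "finite E"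
    using graph finite_subset[of E "Pow V"] by (auto simp: simple_graph_def)
  define N where "N = card V"
  define t where "t = nat \<lceil>2 * Q * ln (real n)\<rceil>"
  define \<L> where "\<L> = {cs. set cs \<subseteq> col ` E \<and> length cs = t}"
  let ?\<S> = "\<lambda>cs v. {S. S \<subseteq> V \<and> v \<in> S \<and> card S = n \<and> cheaply_connected E col cs Q S}"
  from False obtain S\<^sub>0 A\<^sub>0 where S0: "S\<^sub>0 \<subseteq> V" "card S\<^sub>0 = n" and
    "finite A\<^sub>0" "real (card A\<^sub>0) \<le> K * real n"
    "edge_expander l S\<^sub>0 (induced_colored_edges E col S\<^sub>0 A\<^sub>0)"
    by (auto simp: expanding_subsets_def)
  then have Q: "Q \<ge> 1 / 2"
    unfolding Q_def using expander_color_ratio[OF proper, of S\<^sub>0 A\<^sub>0 K l] finV assms(3,4)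
    by (auto intro: finite_subset)
  have N: "N \<ge> 1" using S0 card_mono[OF finV S0(1)] assms(4) by (simp add: N_def)
  have cover: "expanding_subsets V E col l K n \<subseteq> (\<Union>(cs, v)\<in>\<L> \<times> V. ?\<S> cs v)"
  proof
    fix S assume "S \<in> expanding_subsets V E col l K n"
    then obtain A where S: "S \<subseteq> V" "card S = n" and A: "finite A" "real (card A) \<le> K * real n"
      and exp: "edge_expander l S (induced_colored_edges E col S A)"
      by (auto simp: expanding_subsets_def)
    \<comment> \<open>Discarding colours that do not occur in \<open>E\<close> leaves the induced
      graph unchanged and restricts the sequences to a finite alphabet of at most
      \<open>N ^ 2\<close> colours.\<close>
    let ?A = "A \<inter> col ` E"
    have finS: "finite S" using S(1) finV finite_subset by blast
    have "induced_colored_edges E col S ?A = induced_colored_edges E col S A"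
      by (auto simp: induced_colored_edges_def)
    then have exp': "edge_expander l S (induced_colored_edges E col S ?A)" using exp by simp
    have "card ?A \<le> card A" using A(1) by (intro card_mono) auto
    then have card: "real (card ?A) \<le> Q * l * real (card S)"
      using A(2) S(2) assms(3) by (simp add: Q_def)
    \<comment> \<open>With no colours, \<open>expander_color_ratio\<close> would apply with
      \<open>K = 0\<close> and give \<open>0 \<ge> 1 / 2\<close>.\<close>
    have "?A \<noteq> {}"
    proof
      assume "?A = {}"
      then have "real (card ?A) \<le> 0 * real (card S)" by simp
      from expander_color_ratio[OF proper finS _ _ this assms(3) exp'] show False
        using S(2) assms(4) A(1) by simp
    qed
    moreover have "real t \<ge> 2 * Q * ln (real (card S))" unfolding t_def S(2) by linarith
    ultimately obtain cs where "length cs = t" "set cs \<subseteq> ?A" "cheaply_connected E col cs Q S"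
      using expander_cheaply_connected[OF proper finE finS _ _ _ card assms(3) Q exp'] S(2) assms(4) A(1)
      by blast
    moreover obtain v where "v \<in> S" using S(2) assms(4) by fastforce
    ultimately show "S \<in> (\<Union>(cs, v)\<in>\<L> \<times> V. ?\<S> cs v)" using S by (auto simp: \<L>_def)
  qed
  have finL: "finite \<L>" and cardL: "card \<L> = card (col ` E) ^ t"
    unfolding \<L>_def using finE by (auto intro: finite_lists_length_eq simp: card_lists_length_eq)
  have "card (col ` E) \<le> N ^ 2"
    using card_image_le[OF finE] card_edges_le_square[OF graph] unfolding N_def by (rule order.trans)
  then have "card \<L> \<le> (N ^ 2) ^ t" unfolding cardL by (intro power_mono) auto
  then have pairs: "card (\<L> \<times> V) \<le> N ^ (2 * t + 1)"
    unfolding card_cartesian_product N_def[symmetric] power_add power_mult by simp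
  have "card (expanding_subsets V E col l K n) \<le> card (\<Union>(cs, v)\<in>\<L> \<times> V. ?\<S> cs v)"
    using finL finV cover by (intro card_mono) (auto intro: finite_subset[of _ "Pow V"])
  also have "\<dots> \<le> (\<Sum>(cs, v)\<in>\<L> \<times> V. card (?\<S> cs v))"
    using card_UN_le[of "\<L> \<times> V" "\<lambda>(cs, v). ?\<S> cs v"] finL finV by (simp add: case_prod_beta)
  finally have "real (card (expanding_subsets V E col l K n))
      \<le> (\<Sum>(cs, v)\<in>\<L> \<times> V. real (card (?\<S> cs v)))"
    by (simp add: case_prod_beta flip: of_nat_sum)
  also have "\<dots> \<le> (\<Sum>_\<in>\<L> \<times> V. (24 * Q) ^ n)"
    using card_cheaply_connected_le[OF graph proper Q] by (intro sum_mono) auto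
  also have "\<dots> = real (card (\<L> \<times> V)) * (24 * Q) ^ n" by simp
  also have "\<dots> \<le> real (N ^ (2 * t + 1)) * (24 * Q) ^ n"
    using pairs Q by (intro mult_right_mono) (simp_all only: of_nat_le_iff, simp)
  also have "\<dots> \<le> real N powr (24 * Q * ln (real n)) * (24 * Q) ^ n"
  proof (intro mult_right_mono)
    \<comment> \<open>The rounding in \<open>t\<close> gives
      \<open>2 * t + 1 \<le> 4 * Q * ln n + 3\<close>. Since \<open>ln n \<ge> 1 / 2\<close> and
      \<open>Q \<ge> 1 / 2\<close>, the product \<open>Q * ln n\<close> is at least
      \<open>1 / 4\<close>, so the constant 3 is absorbed.\<close>
    have "1 \<le> ln (4 :: real)" using exp_le by (subst ln_ge_iff) auto
    also have "ln (4 :: real) = 2 * ln 2" using ln_realpow[of 2 2] by simp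
    also have "\<dots> \<le> 2 * ln (real n)" using assms(4) by simp
    finally have "1 / 2 * (1 / 2) \<le> Q * ln (real n)" using Q by (intro mult_mono) auto
    moreover have "real t \<le> 2 * Q * ln (real n) + 1"
      using calculation unfolding t_def by linarith
    ultimately have "real (2 * t + 1) \<le> 24 * Q * ln (real n)" by simp
    then have "real N powr real (2 * t + 1) \<le> real N powr (24 * Q * ln (real n))"
      using N by (intro powr_mono) auto
    then show "real (N ^ (2 * t + 1)) \<le> real N powr (24 * Q * ln (real n))"
      using N by (simp only: of_nat_power) (subst (asm) powr_realpow, auto)
  qed (use Q in simp)
  finally show ?thesis unfolding N_def .
qed


theorem theorem2p3:
  "\<exists>C::real. C > 0 \<and>
    (\<forall>(V :: 'a set) (E :: 'a set set) (col :: 'a set \<Rightarrow> 'c) (\<Delta> :: nat) (l :: real) (K :: real) (n :: nat).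
      simple_graph V E \<longrightarrow>
      (\<forall>c. max_degree_at_most V (color_class E col c) \<Delta>) \<longrightarrow>
      0 < l \<longrightarrow> l \<le> 1 \<longrightarrow> K > 0 \<longrightarrow> n \<ge> 2 \<longrightarrow>
      real (card (expanding_subsets V E col l K n))
        \<le> real (card V) powr (C * real \<Delta> * inverse l * K * ln (real n)) *
          (C * real \<Delta> * inverse l * K) ^ n)"
proof (intro exI[of _ 48] conjI allI impI)
  fix V :: "'a set" and E :: "'a set set" and col :: "'a set \<Rightarrow> 'c"
    and \<Delta> :: nat and l K :: real and n :: nat
  assume graph: "simple_graph V E" and deg: "\<forall>c. max_degree_at_most V (color_class E col c) \<Delta>"
    and "0 < l" "K > 0" "n \<ge> 2"
  have finV: "finite V" and finE: "finite E"
    using graph finite_subset[of E "Pow V"] by (auto simp: simple_graph_def)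
  have "card {e \<in> E. v \<in> e \<and> col e = c} \<le> \<Delta>" for c v
  proof (cases "v \<in> V")
    case True
    have "{e \<in> E. v \<in> e \<and> col e = c} = {e \<in> color_class E col c. v \<in> e}"
      by (auto simp: color_class_def)
    then show ?thesis using deg True by (simp add: max_degree_at_most_def degree_def)
  next
    case False
    then have "{e \<in> E. v \<in> e \<and> col e = c} = {}" using graph by (auto simp: simple_graph_def)
    then show ?thesis by (simp only: card.empty)
  qed
  then obtain g where g: "\<forall>e\<in>E. g e < 2 * \<Delta>" "properly_colored E (\<lambda>e. (col e, g e :: nat))"
    using proper_refinement_exists[OF finE, of col \<Delta>] graph by (auto simp: simple_graph_def)
  let ?col = "\<lambda>e. (col e, g e)"
  \<comment> \<open>Each old colour splits into at most \<open>2 * \<Delta>\<close> refined ones;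
    this factor 2 turns the constant 24 into 48.\<close>
  let ?K = "2 * real \<Delta> * K"
  have "expanding_subsets V E col l K n \<subseteq> expanding_subsets V E ?col l ?K n"
  proof
    fix S assume "S \<in> expanding_subsets V E col l K n"
    then obtain A where S: "S \<subseteq> V" "card S = n" and A: "finite A" "real (card A) \<le> K * real n"
      and exp: "edge_expander l S (induced_colored_edges E col S A)"
      by (auto simp: expanding_subsets_def)
    let ?A = "A \<times> {..<2 * \<Delta>}"
    have "induced_colored_edges E ?col S ?A = induced_colored_edges E col S A"
      using g(1) by (auto simp: induced_colored_edges_def)
    then have exp': "edge_expander l S (induced_colored_edges E ?col S ?A)" using exp by simp
    have card: "real (card ?A) \<le> ?K * real n"
      using mult_left_mono[OF A(2), of "2 * real \<Delta>"] by (simp add: card_cartesian_product mult_ac)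
    show "S \<in> expanding_subsets V E ?col l ?K n"
      unfolding expanding_subsets_def mem_Collect_eq
      by (intro conjI exI[of _ ?A] S exp' card) (simp add: A(1))
  qed
  moreover have "finite (expanding_subsets V E ?col l ?K n)"
    using finV by (auto simp: expanding_subsets_def intro: finite_subset[of _ "Pow V"])
  ultimately have "real (card (expanding_subsets V E col l K n))
      \<le> real (card (expanding_subsets V E ?col l ?K n))"
    by (simp add: card_mono)
  also have "\<dots> \<le> real (card V) powr (24 * (?K / l) * ln (real n)) * (24 * (?K / l)) ^ n"
    using card_expanding_subsets_properly_colored[OF graph g(2) \<open>0 < l\<close> \<open>n \<ge> 2\<close>, of ?K] \<open>K > 0\<close>
    by simp
  also have "24 * (?K / l) = 48 * real \<Delta> * inverse l * K"
    by (simp add: divide_inverse mult_ac)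
  finally show "real (card (expanding_subsets V E col l K n))
      \<le> real (card V) powr (48 * real \<Delta> * inverse l * K * ln (real n)) *
        (48 * real \<Delta> * inverse l * K) ^ n" .
qed simp

end
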